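(* Let $\alpha=(\alpha_1,\dots,\alpha_k)$ be a composition of positive integers for which there exists $J$ with $1\le J\le k$ such that $\alpha_\ell\ge\ell$ for $1\le\ell\le J$ and $\alpha_\ell=J$ for $J+1\le\ell\le k$. Then $$\mathfrak{S}_\alpha=\sum_{\sigma\in S_k}\mathrm{sgn}(\sigma)\,R_{(\alpha_1-1+\sigma_1,\ \alpha_2-2+\sigma_2,\ \dots,\ \alpha_k-k+\sigma_k)},$$ with the convention that $R_\beta$ vanishes if $\beta$ contains any nonpositive parts.
   Context: Let $\mathbf{K}$ be a field of characteristic zero and $\mathrm{NSym}=\mathbf{K}\langle H_1,H_2,\dots\rangle$ the free associative algebra on noncommuting generators; $H_0=1$, $H_a=0$ for $a<0$, $H_{(\alpha_1,\dots,\alpha_k)}=H_{\alpha_1}\cdots H_{\alpha_k}$. For $\mu\in\mathbb{Z}^k$, the immaculate noncommutative symmetric function $\mathfrak{S}_\mu\in\mathrm{NSym}$ is given by the (known) noncommutative Jacobi–Trudi formula $\mathfrak{S}_\mu=\sum_{\sigma\in S_k}\mathrm{sgn}(\sigma)H_{\mu_1-1+\sigma_1}H_{\mu_2-2+\sigma_2}\cdots H_{\mu_k-k+\sigma_k}$ (factors in this order). For a composition $\alpha$ (sequence of positive integers), the ribbon function is $R_\alpha=\sum_{\beta\succeq\alpha}(-1)^{\ell(\beta)-\ell(\alpha)}H_\beta$, where $\beta\succeq\alpha$ means that $\beta$ is a coarsening of $\alpha$ (obtained by adding together groups of consecutive parts of $\alpha$) and $\ell$ is the number of parts. Permutations are written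 in one-line notation $\sigma=(\sigma_1,\dots,\sigma_k)$. *)

theory Defs
  imports "HOL-Library.Poly_Mapping" "HOL-Combinatorics.Permutations"
begin

datatype 'a free_monoid = Word (letters: "'a list")

instantiation free_monoid :: (type) monoid_add
begin

definition zero_free_monoid :: "'a free_monoid"
  where "0 = Word []"

definition plus_free_monoid :: "'a free_monoid \<Rightarrow> 'a free_monoid \<Rightarrow> 'a free_monoid"
  where "u + v = Word (letters u @ letters v)"

instance
  by standard (simp_all add: zero_free_monoid_def plus_free_monoid_def)

end

text \<open>
  The free associative algebra on \<open>H\<^sub>1, H\<^sub>2, \<dots>\<close> is the monoid algebra of the free monoid: the
  finitely supported functions on words, with convolution as product. The letter \<open>n\<close> stands for
  the generator \<open>H\<^bsub>n+1\<^esub>\<close>.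
\<close>

type_synonym 'k nsym = "nat free_monoid \<Rightarrow>\<^sub>0 'k"

definition H :: "int \<Rightarrow> 'k::field_char_0 nsym"
  where "H a = (if a < 0 then 0 else if a = 0 then 1
                else Poly_Mapping.single (Word [nat (a - 1)]) 1)"

definition H_list :: "int list \<Rightarrow> 'k::field_char_0 nsym"
  where "H_list \<alpha> = prod_list (map H \<alpha>)"

text \<open>The sequence \<open>(\<mu>\<^sub>1 - 1 + \<sigma>\<^sub>1, \<dots>, \<mu>\<^sub>k - k + \<sigma>\<^sub>k)\<close>; lists are indexed from 0, permutations from 1.\<close>

definition perm_shift :: "int list \<Rightarrow> (nat \<Rightarrow> nat) \<Rightarrow> int list"
  where "perm_shift \<mu> \<sigma> = map (\<lambda>i. \<mu> ! (i - 1) - int i + int (\<sigma> i)) [1..<length \<mu> + 1]"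

definition immaculate :: "int list \<Rightarrow> 'k::field_char_0 nsym"
  where "immaculate \<mu> =
    (\<Sum>\<sigma> | \<sigma> permutes {1..length \<mu>}. of_int (sign \<sigma>) * H_list (perm_shift \<mu> \<sigma>))"

definition is_composition :: "int list \<Rightarrow> bool"
  where "is_composition \<alpha> \<longleftrightarrow> (\<forall>a\<in>set \<alpha>. 0 < a)"

definition coarsening :: "int list \<Rightarrow> int list \<Rightarrow> bool"
  where "coarsening \<beta> \<alpha> \<longleftrightarrow>
    (\<exists>blocks. concat blocks = \<alpha> \<and> [] \<notin> set blocks \<and> \<beta> = map sum_list blocks)"

lemma finite_coarsenings: "finite {\<beta>. coarsening \<beta> \<alpha>}"
proof -
  let ?A = "{xs. set xs \<subseteq> set \<alpha> \<and> length xs \<le> length \<alpha>}"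
  let ?B = "{blocks. set blocks \<subseteq> ?A \<and> length blocks \<le> length \<alpha>}"
  have len: "length bs \<le> length (concat bs)" if "[] \<notin> set bs" for bs :: "int list list"
    using that
  proof (induction bs)
    case (Cons b bs)
    then show ?case by (cases b) auto
  qed simp
  have mem: "length b \<le> length (concat bs)" if "b \<in> set bs" for b and bs :: "int list list"
    using that by (induction bs) auto
  have "{\<beta>. coarsening \<beta> \<alpha>} \<subseteq> map sum_list ` ?B"
  proof
    fix \<beta> assume "\<beta> \<in> {\<beta>. coarsening \<beta> \<alpha>}"
    then obtain bs where bs: "concat bs = \<alpha>" "[] \<notin> set bs" "\<beta> = map sum_list bs"
      by (auto simp: coarsening_def)
    have "b \<in> ?A" if "b \<in> set bs" for b
      using that mem[OF that] bs(1) by auto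
    moreover have "length bs \<le> length \<alpha>"
      using len[OF bs(2)] bs(1) by simp
    ultimately show "\<beta> \<in> map sum_list ` ?B"
      unfolding bs(3) by blast
  qed
  moreover have "finite ?B"
    by (rule finite_lists_length_le[OF finite_lists_length_le[OF finite_set]])
  ultimately show ?thesis
    by (meson finite_imageI finite_subset)
qed

text \<open>
  The sign \<open>(-1)\<^bsup>\<ell>(\<beta>) - \<ell>(\<alpha>)\<^esup>\<close> is written with the exponent \<open>\<ell>(\<alpha>) - \<ell>(\<beta>)\<close> of the same parity,
  which is a natural number because \<open>\<beta>\<close> is coarser than \<open>\<alpha>\<close>.
\<close>

definition ribbon :: "int list \<Rightarrow> 'k::field_char_0 nsym"
  where "ribbon \<alpha> =
    (if is_composition \<alpha>
     then \<Sum>\<beta> | coarsening \<beta> \<alpha>. (- 1) ^ (length \<alpha> - length \<beta>) * H_list \<beta>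
     else 0)"

end

theory Submission
  imports Defs
begin

text \<open>
  Write \<open>x = (x\<^sub>1, \<dots>, x\<^sub>k)\<close> for the sequence \<open>\<alpha>\<^sub>i - i + \<sigma>\<^sub>i\<close>. The two sides of the theorem are the
  ends of a chain of signed sums over all \<open>\<sigma>\<close>, whose \<open>p\<close>-th member has the summand
  \<open>R(x\<^sub>1, \<dots>, x\<^sub>p) H(x\<^bsub>p+1\<^esub>) \<dots> H(x\<^sub>k)\<close>, the indices being written as arguments.
  For \<open>p = 1\<close> this is the Jacobi-Trudi sum, since \<open>\<alpha>\<^sub>1 \<ge> 1\<close> gives \<open>x\<^sub>1 > 0\<close>, and for
  \<open>p = k\<close> it is the sum of ribbons. So it suffices that the sums for \<open>p\<close> and \<open>p + 1\<close> agree.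

  By the multiplication rule for ribbons (lemma \<open>ribbon_append2\<close>) the two summands differ by
  \<open>R(x\<^sub>1, \<dots>, x\<^bsub>p-1\<^esub>, x\<^sub>p + x\<^bsub>p+1\<^esub>) H(x\<^bsub>p+2\<^esub>) \<dots> H(x\<^sub>k)\<close>
  if \<open>x\<^sub>1, \<dots>, x\<^sub>p > 0\<close> and \<open>x\<^bsub>p+1\<^esub> \<ge> 0\<close>, and by nothing otherwise (lemma \<open>ribbon_times_H_diff\<close>);
  the boundary case \<open>x\<^bsub>p+1\<^esub> = 0\<close> belongs to the first alternative because \<open>H\<^sub>0 = 1\<close>. The
  product depends on \<open>\<sigma>\<^sub>p\<close> and \<open>\<sigma>\<^bsub>p+1\<^esub>\<close> only through their sum, so the signed sum of the differences
  cancels under the exchange of these two values, as soon as the condition \<open>x\<^sub>p > 0 \<and> x\<^bsub>p+1\<^esub> \<ge> 0\<close>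
  is invariant under it (lemma \<open>hybrid_sum_Suc\<close>). This is where the hypothesis on \<open>\<alpha>\<close> enters. If
  \<open>p < J\<close>, the condition always holds. If \<open>p = J + m\<close> with \<open>m \<ge> 0\<close>, it says that \<open>\<sigma>\<^sub>p\<close> and
  \<open>\<sigma>\<^bsub>p+1\<^esub>\<close> are both at least \<open>m + 1\<close>: the strict inequality in row \<open>p\<close> and the weak one in row
  \<open>p + 1\<close> compensate the shift by one between the rows.
\<close>

section \<open>The multiplication rule for ribbons\<close>

lemma is_composition_append [simp]:
  "is_composition (xs @ ys) \<longleftrightarrow> is_composition xs \<and> is_composition ys"
  by (auto simp: is_composition_def)

lemma is_composition_Nil [simp]: "is_composition []"
  by (simp add: is_composition_def)

lemma is_composition_Cons [simp]: "is_composition (x # xs) \<longleftrightarrow> 0 < x \<and> is_composition xs"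
  by (auto simp: is_composition_def)

lemma H_list_append [simp]: "H_list (xs @ ys) = H_list xs * H_list ys"
  by (simp add: H_list_def)

lemma H_list_Nil [simp]: "H_list [] = 1"
  by (simp add: H_list_def)

lemma H_list_Cons [simp]: "H_list (x # xs) = H x * H_list xs"
  by (simp add: H_list_def)

lemma coarsening_length_le:
  assumes "coarsening \<beta> \<alpha>"
  shows "length \<beta> \<le> length \<alpha>"
proof -
  have "length bs \<le> length (concat bs)" if "[] \<notin> set bs" for bs :: "int list list"
    using that
  proof (induction bs)
    case (Cons b bs)
    then show ?case by (cases b) auto
  qed simp
  then show ?thesis
    using assms by (auto simp: coarsening_def)
qed

lemma coarsening_singleton: "coarsening \<beta> [a] \<longleftrightarrow> \<beta> = [a]"
proof
  assume "coarsening \<beta> [a]"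
  then obtain bs where bs: "concat bs = [a]" "[] \<notin> set bs" "\<beta> = map sum_list bs"
    by (auto simp: coarsening_def)
  then have "bs = [[a]]"
  proof (cases bs)
    case (Cons c cs)
    then have "c = [a]" "concat cs = []"
      using bs by (auto simp: append_eq_Cons_conv)
    moreover have "cs = []"
      using \<open>concat cs = []\<close> bs(2) Cons by (cases cs) auto
    ultimately show ?thesis using Cons by simp
  qed simp
  then show "\<beta> = [a]" using bs(3) by simp
next
  assume "\<beta> = [a]"
  then show "coarsening \<beta> [a]"
    unfolding coarsening_def by (intro exI[of _ "[[a]]"]) simp
qed

text \<open>The two alternatives are that the last block is \<open>[b]\<close>, or that it also contains \<open>a\<close>.\<close>

lemma coarsening_append2:
  "coarsening \<gamma> (xs @ [a, b]) \<longleftrightarrow>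
     (\<exists>\<beta>. coarsening \<beta> (xs @ [a]) \<and> \<gamma> = \<beta> @ [b]) \<or> coarsening \<gamma> (xs @ [a + b])"
    (is "?L \<longleftrightarrow> ?R1 \<or> ?R2")
proof
  assume ?L
  then obtain bs where bs: "concat bs = xs @ [a, b]" "[] \<notin> set bs" "\<gamma> = map sum_list bs"
    by (auto simp: coarsening_def)
  then have "bs \<noteq> []" by auto
  then obtain bs' c where c: "bs = bs' @ [c]" by (metis rev_exhaust)
  with bs have "c \<noteq> []" by auto
  then obtain d b' where d: "c = d @ [b']" by (metis rev_exhaust)
  have "(concat bs' @ d) @ [b'] = (xs @ [a]) @ [b]"
    using bs(1) c d by simp
  then have eq: "concat bs' @ d = xs @ [a]" "b' = b"
    unfolding append1_eq_conv by auto
  show "?R1 \<or> ?R2"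
  proof (cases "d = []")
    case True
    then have ?R1
      using eq bs c d unfolding coarsening_def
      by (intro exI[of _ "map sum_list bs'"] conjI exI[of _ bs']) auto
    then show ?thesis ..
  next
    case False
    then obtain e a' where e: "d = e @ [a']" by (metis rev_exhaust)
    with eq have "concat bs' @ e = xs" "a' = a"
      by (metis append.assoc append1_eq_conv)+
    then have ?R2
      using eq bs c d e unfolding coarsening_def
      by (intro exI[of _ "bs' @ [e @ [a + b]]"]) auto
    then show ?thesis ..
  qed
next
  assume "?R1 \<or> ?R2"
  then show ?L
  proof
    assume ?R1
    then obtain bs where "concat bs = xs @ [a]" "[] \<notin> set bs" "\<gamma> = map sum_list bs @ [b]"
      by (auto simp: coarsening_def)
    then show ?L
      unfolding coarsening_def by (intro exI[of _ "bs @ [[b]]"]) auto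
  next
    assume ?R2
    then obtain bs where bs: "concat bs = xs @ [a + b]" "[] \<notin> set bs" "\<gamma> = map sum_list bs"
      by (auto simp: coarsening_def)
    then have "bs \<noteq> []" by auto
    then obtain bs' c where c: "bs = bs' @ [c]" by (metis rev_exhaust)
    with bs have "c \<noteq> []" by auto
    then obtain d s where d: "c = d @ [s]" by (metis rev_exhaust)
    have "(concat bs' @ d) @ [s] = xs @ [a + b]"
      using bs(1) c d by simp
    then have "concat bs' @ d = xs" "s = a + b" by auto
    then show ?L
      using bs c d unfolding coarsening_def
      by (intro exI[of _ "bs' @ [d @ [a, b]]"]) auto
  qed
qed

lemma coarsening_last_ge:
  assumes "coarsening \<gamma> (xs @ [s])" and "is_composition xs"
  shows "s \<le> last \<gamma>"
proof -
  obtain bs where bs: "concat bs = xs @ [s]" "[] \<notin> set bs" "\<gamma> = map sum_list bs"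
    using assms(1) by (auto simp: coarsening_def)
  then have "bs \<noteq> []" by auto
  then obtain bs' c where c: "bs = bs' @ [c]" by (metis rev_exhaust)
  with bs have "c \<noteq> []" by auto
  then obtain d t where d: "c = d @ [t]" by (metis rev_exhaust)
  have "(concat bs' @ d) @ [t] = xs @ [s]"
    using bs(1) c d by simp
  then have t: "concat bs' @ d = xs" "t = s" by auto
  then have "0 \<le> sum_list d"
    using assms(2) by (intro sum_list_nonneg) (auto simp: is_composition_def less_imp_le)
  then show ?thesis
    using bs(3) c d t by simp
qed

lemma ribbon_singleton: "0 < a \<Longrightarrow> ribbon [a] = H a"
  by (simp add: ribbon_def coarsening_singleton)

text \<open>
  This is the rule \<open>R\<^sub>\<alpha> H\<^sub>b = R\<^bsub>\<alpha>\<cdot>b\<^esub> + R\<^bsub>\<alpha>\<odot>b\<^esub>\<close> for concatenation and near-concatenation.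
  Positivity of the parts separates the two families of coarsenings: the last part of a
  coarsening is \<open>b\<close> in the first family and at least \<open>a + b\<close> in the second.
\<close>

lemma ribbon_append2:
  assumes "is_composition xs" and "0 < a" and "0 < b"
  shows "(ribbon (xs @ [a, b]) :: 'k::field_char_0 nsym) =
    ribbon (xs @ [a]) * H b - ribbon (xs @ [a + b])"
proof -
  let ?A = "{\<beta>. coarsening \<beta> (xs @ [a])}" and ?B = "{\<beta>. coarsening \<beta> (xs @ [a + b])}"
  let ?f = "\<lambda>\<beta>. (- 1) ^ (Suc (Suc (length xs)) - length \<beta>) * H_list \<beta> :: 'k nsym"
  let ?g = "\<lambda>\<beta>. (- 1) ^ (Suc (length xs) - length \<beta>) * H_list \<beta> :: 'k nsym"
  have split: "{\<gamma>. coarsening \<gamma> (xs @ [a, b])} = (\<lambda>\<beta>. \<beta> @ [b]) ` ?A \<union> ?B"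
    by (auto simp: coarsening_append2)
  have disj: "(\<lambda>\<beta>. \<beta> @ [b]) ` ?A \<inter> ?B = {}"
  proof -
    have False if "coarsening (\<beta> @ [b]) (xs @ [a + b])" for \<beta>
      using coarsening_last_ge[OF that assms(1)] assms(2) by simp
    then show ?thesis by blast
  qed
  have "(ribbon (xs @ [a, b]) :: 'k nsym) = sum ?f ((\<lambda>\<beta>. \<beta> @ [b]) ` ?A \<union> ?B)"
    using assms by (simp add: ribbon_def split)
  also have "\<dots> = sum ?f ((\<lambda>\<beta>. \<beta> @ [b]) ` ?A) + sum ?f ?B"
    using disj by (intro sum.union_disjoint) (auto simp: finite_coarsenings)
  also have "sum ?f ((\<lambda>\<beta>. \<beta> @ [b]) ` ?A) = (\<Sum>\<beta>\<in>?A. ?g \<beta> * H b)"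
    by (subst sum.reindex) (auto simp: inj_on_def mult.assoc)
  also have "\<dots> = ribbon (xs @ [a]) * H b"
    using assms by (simp add: ribbon_def sum_distrib_right)
  also have "sum ?f ?B = (\<Sum>\<beta>\<in>?B. - ?g \<beta>)"
  proof (intro sum.cong refl)
    fix \<beta> assume "\<beta> \<in> ?B"
    then have "length \<beta> \<le> Suc (length xs)"
      using coarsening_length_le by fastforce
    then show "?f \<beta> = - ?g \<beta>"
      by (simp add: Suc_diff_le)
  qed
  also have "\<dots> = - ribbon (xs @ [a + b])"
    using assms by (simp add: ribbon_def sum_negf)
  finally show ?thesis by simp
qed

lemma ribbon_not_composition: "\<not> is_composition \<alpha> \<Longrightarrow> ribbon \<alpha> = 0"
  by (simp add: ribbon_def)

text \<open>
  For \<open>b = 0\<close> the difference is \<open>R\<^bsub>xs\<cdot>a\<^esub> H\<^sub>0 - 0\<close>, which has the same form as for \<open>b > 0\<close>;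
  so the condition on \<open>b\<close> is weak while that on \<open>a\<close> is strict.
\<close>

lemma ribbon_times_H_diff:
  "(ribbon (xs @ [a]) * H b - ribbon (xs @ [a, b]) :: 'k::field_char_0 nsym) =
    (if is_composition xs \<and> 0 < a \<and> 0 \<le> b then ribbon (xs @ [a + b]) else 0)"
proof (cases "is_composition xs \<and> 0 < a")
  case True
  consider "b < 0" | "b = 0" | "0 < b" by linarith
  then show ?thesis
  proof cases
    case 3
    then show ?thesis using True by (simp add: ribbon_append2)
  qed (use True in \<open>simp_all add: H_def ribbon_not_composition\<close>)
qed (auto simp: ribbon_not_composition)


section \<open>Cancellation in signed sums over permutations\<close>

text \<open>
  Composition with the transposition matches the even permutations with the odd ones, so the
  sum vanishes over every ring, also in the presence of 2-torsion.
\<close>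

lemma sum_sign_permutes_eq_0:
  fixes g :: "('a \<Rightarrow> 'a) \<Rightarrow> 'b::ring_1"
  assumes "finite S" and "a \<in> S" and "b \<in> S" and "a \<noteq> b"
    and inv: "\<And>\<sigma>. \<sigma> permutes S \<Longrightarrow> g (\<sigma> \<circ> transpose a b) = g \<sigma>"
  shows "(\<Sum>\<sigma> | \<sigma> permutes S. of_int (sign \<sigma>) * g \<sigma>) = 0"
proof -
  let ?t = "\<lambda>\<sigma>. \<sigma> \<circ> transpose a b"
  let ?E = "{\<sigma>. \<sigma> permutes S \<and> evenperm \<sigma>}" and ?O = "{\<sigma>. \<sigma> permutes S \<and> \<not> evenperm \<sigma>}"
  have fin: "finite {\<sigma>. \<sigma> permutes S}"
    using assms(1) by (rule finite_permutations)
  have perm: "?t \<sigma> permutes S" if "\<sigma> permutes S" for \<sigma>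
    using that assms by (intro permutes_compose permutes_swap_id)
  have parity: "evenperm (?t \<sigma>) \<longleftrightarrow> \<not> evenperm \<sigma>" if "\<sigma> permutes S" for \<sigma>
  proof -
    have "permutation \<sigma>"
      using that assms(1) by (auto simp: permutation_permutes)
    then show ?thesis
      using assms(4) by (simp add: evenperm_comp permutation_swap_id evenperm_swap)
  qed
  have "(\<Sum>\<sigma>\<in>?E. g \<sigma>) = (\<Sum>\<sigma>\<in>?O. g \<sigma>)"
    by (rule sum.reindex_bij_witness[where i = ?t and j = ?t])
       (auto simp: perm parity inv comp_assoc)
  moreover have "(\<Sum>\<sigma> | \<sigma> permutes S. of_int (sign \<sigma>) * g \<sigma>) =
      (\<Sum>\<sigma>\<in>?E. of_int (sign \<sigma>) * g \<sigma>) + (\<Sum>\<sigma>\<in>?O. of_int (sign \<sigma>) * g \<sigma>)"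
  proof -
    have "{\<sigma>. \<sigma> permutes S} = ?E \<union> ?O" "?E \<inter> ?O = {}" by auto
    moreover have "finite ?E" "finite ?O" using fin by simp_all
    ultimately show ?thesis by (metis (no_types, lifting) sum.union_disjoint)
  qed
  moreover have "(\<Sum>\<sigma>\<in>?E. of_int (sign \<sigma>) * g \<sigma>) = (\<Sum>\<sigma>\<in>?E. g \<sigma>)"
    by (intro sum.cong) (auto simp: sign_def)
  moreover have "(\<Sum>\<sigma>\<in>?O. of_int (sign \<sigma>) * g \<sigma>) = - (\<Sum>\<sigma>\<in>?O. g \<sigma>)"
    unfolding sum_negf[symmetric] by (intro sum.cong) (auto simp: sign_def)
  ultimately show ?thesis by simp
qed


section \<open>Passing from products of generators to ribbons one factor at a time\<close>

lemma length_perm_shift [simp]: "length (perm_shift \<alpha> \<sigma>) = length \<alpha>"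
  unfolding perm_shift_def length_map length_upt by simp

definition hybrid_sum :: "int list \<Rightarrow> nat \<Rightarrow> 'k::field_char_0 nsym"
  where "hybrid_sum \<alpha> p = (\<Sum>\<sigma> | \<sigma> permutes {1..length \<alpha>}.
    of_int (sign \<sigma>) * (ribbon (take p (perm_shift \<alpha> \<sigma>)) * H_list (drop p (perm_shift \<alpha> \<sigma>))))"

text \<open>
  The hypothesis \<open>sym\<close> says that exchanging the values \<open>u = \<sigma>\<^sub>p\<close> and \<open>v = \<sigma>\<^bsub>p+1\<^esub>\<close> preserves the
  condition under which the two summands differ.
\<close>

lemma hybrid_sum_Suc:
  assumes p: "1 \<le> p" "p < length \<alpha>"
    and sym: "\<And>u v :: nat. \<lbrakk>1 \<le> u; 1 \<le> v;
        0 < \<alpha> ! (p - 1) - int p + int u; 0 \<le> \<alpha> ! p - int (Suc p) + int v\<rbrakk>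
      \<Longrightarrow> 0 < \<alpha> ! (p - 1) - int p + int v \<and> 0 \<le> \<alpha> ! p - int (Suc p) + int u"
  shows "(hybrid_sum \<alpha> (Suc p) :: 'k::field_char_0 nsym) = hybrid_sum \<alpha> p"
proof -
  define f where "f = (\<lambda>\<sigma> i. \<alpha> ! (i - 1) - int i + int (\<sigma> i))"
  define xs where "xs = (\<lambda>\<sigma>. map (f \<sigma>) [1..<p])"
  define ys where "ys = (\<lambda>\<sigma>. map (f \<sigma>) [p + 2..<length \<alpha> + 1])"
  define g :: "(nat \<Rightarrow> nat) \<Rightarrow> 'k nsym" where "g = (\<lambda>\<sigma>.
    if is_composition (xs \<sigma>) \<and> 0 < f \<sigma> p \<and> 0 \<le> f \<sigma> (Suc p)
    then ribbon (xs \<sigma> @ [f \<sigma> p + f \<sigma> (Suc p)]) * H_list (ys \<sigma>) else 0)"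
  have "[1..<length \<alpha> + 1] = [1..<p] @ [p..<length \<alpha> + 1]"
    using p upt_add_eq_append[of 1 p "length \<alpha> + 1 - p"] by simp
  also have "[p..<length \<alpha> + 1] = [p, Suc p] @ [p + 2..<length \<alpha> + 1]"
    using p by (simp add: upt_conv_Cons)
  finally have shift: "perm_shift \<alpha> \<sigma> = xs \<sigma> @ [f \<sigma> p, f \<sigma> (Suc p)] @ ys \<sigma>" for \<sigma>
    by (simp add: perm_shift_def f_def xs_def ys_def)
  have len: "length (xs \<sigma>) = p - 1" for \<sigma>
    by (simp add: xs_def)
  have take_drop:
    "take p (perm_shift \<alpha> \<sigma>) = xs \<sigma> @ [f \<sigma> p]"
    "drop p (perm_shift \<alpha> \<sigma>) = f \<sigma> (Suc p) # ys \<sigma>"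
    "take (Suc p) (perm_shift \<alpha> \<sigma>) = xs \<sigma> @ [f \<sigma> p, f \<sigma> (Suc p)]"
    "drop (Suc p) (perm_shift \<alpha> \<sigma>) = ys \<sigma>" for \<sigma>
    using p by (auto simp: shift len Suc_diff_le)
  have diff: "ribbon (take p (perm_shift \<alpha> \<sigma>)) * H_list (drop p (perm_shift \<alpha> \<sigma>))
      - ribbon (take (Suc p) (perm_shift \<alpha> \<sigma>)) * H_list (drop (Suc p) (perm_shift \<alpha> \<sigma>)) = g \<sigma>"
    for \<sigma>
  proof -
    have "ribbon (xs \<sigma> @ [f \<sigma> p]) * (H (f \<sigma> (Suc p)) * H_list (ys \<sigma>))
        - ribbon (xs \<sigma> @ [f \<sigma> p, f \<sigma> (Suc p)]) * H_list (ys \<sigma>)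
      = (ribbon (xs \<sigma> @ [f \<sigma> p]) * H (f \<sigma> (Suc p))
        - ribbon (xs \<sigma> @ [f \<sigma> p, f \<sigma> (Suc p)])) * (H_list (ys \<sigma>) :: 'k nsym)"
      by (simp add: left_diff_distrib mult.assoc)
    then show ?thesis
      by (simp add: take_drop g_def ribbon_times_H_diff)
  qed
  have inv: "g (\<sigma> \<circ> transpose p (Suc p)) = g \<sigma>" if \<sigma>: "\<sigma> permutes {1..length \<alpha>}" for \<sigma>
  proof -
    let ?\<tau> = "\<sigma> \<circ> transpose p (Suc p)"
    have "xs ?\<tau> = xs \<sigma>" "ys ?\<tau> = ys \<sigma>"
      by (auto simp: xs_def ys_def f_def transpose_def)
    moreover have "f ?\<tau> p + f ?\<tau> (Suc p) = f \<sigma> p + f \<sigma> (Suc p)"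
      by (simp add: f_def)
    moreover have "\<sigma> p \<in> {1..length \<alpha>}" "\<sigma> (Suc p) \<in> {1..length \<alpha>}"
      unfolding permutes_in_image[OF \<sigma>] using p by auto
    then have "0 < f ?\<tau> p \<and> 0 \<le> f ?\<tau> (Suc p) \<longleftrightarrow> 0 < f \<sigma> p \<and> 0 \<le> f \<sigma> (Suc p)"
      using sym[of "\<sigma> p" "\<sigma> (Suc p)"] sym[of "\<sigma> (Suc p)" "\<sigma> p"] by (auto simp: f_def)
    ultimately show ?thesis
      by (simp add: g_def)
  qed
  have "hybrid_sum \<alpha> p - hybrid_sum \<alpha> (Suc p) =
      (\<Sum>\<sigma> | \<sigma> permutes {1..length \<alpha>}. of_int (sign \<sigma>) * g \<sigma>)"
    unfolding hybrid_sum_def sum_subtractf[symmetric] right_diff_distrib[symmetric] diff ..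
  also have "\<dots> = 0"
    using p inv by (intro sum_sign_permutes_eq_0[where a = p and b = "Suc p"]) auto
  finally show ?thesis by simp
qed

lemma hybrid_sum_1:
  assumes "\<alpha> \<noteq> []" and "1 \<le> \<alpha> ! 0"
  shows "hybrid_sum \<alpha> 1 = immaculate \<alpha>"
  unfolding hybrid_sum_def immaculate_def
proof (intro sum.cong refl arg_cong2[of _ _ _ _ "(*)"])
  fix \<sigma> assume "\<sigma> \<in> {\<sigma>. \<sigma> permutes {1..length \<alpha>}}"
  then have "\<sigma> 1 \<in> {1..length \<alpha>}"
    using assms(1) by (subst permutes_in_image) (auto simp: Suc_le_eq)
  moreover obtain xs where "perm_shift \<alpha> \<sigma> = (\<alpha> ! 0 - 1 + int (\<sigma> 1)) # xs"
    using assms(1) by (simp add: perm_shift_def upt_conv_Cons del: upt_Suc)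
  ultimately show "ribbon (take 1 (perm_shift \<alpha> \<sigma>)) * H_list (drop 1 (perm_shift \<alpha> \<sigma>)) =
      H_list (perm_shift \<alpha> \<sigma>)"
    using assms(2) by (simp add: ribbon_singleton)
qed

lemma hybrid_sum_length:
  "hybrid_sum \<alpha> (length \<alpha>) =
    (\<Sum>\<sigma> | \<sigma> permutes {1..length \<alpha>}. of_int (sign \<sigma>) * ribbon (perm_shift \<alpha> \<sigma>))"
  by (simp add: hybrid_sum_def)


section \<open>The ribbon expansion\<close>

theorem theorem6p14:
  fixes \<alpha> :: "int list"
  assumes "is_composition \<alpha>"
    and "\<exists>J::nat. 1 \<le> J \<and> J \<le> length \<alpha> \<and>
           (\<forall>l. 1 \<le> l \<and> l \<le> J \<longrightarrow> \<alpha> ! (l - 1) \<ge> int l) \<and>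
           (\<forall>l. J + 1 \<le> l \<and> l \<le> length \<alpha> \<longrightarrow> \<alpha> ! (l - 1) = int J)"
  shows "(immaculate \<alpha> :: 'k::field_char_0 nsym) =
    (\<Sum>\<sigma> | \<sigma> permutes {1..length \<alpha>}. of_int (sign \<sigma>) * ribbon (perm_shift \<alpha> \<sigma>))"
proof -
  obtain J where J: "1 \<le> J" "J \<le> length \<alpha>"
    and low: "\<forall>l. 1 \<le> l \<and> l \<le> J \<longrightarrow> \<alpha> ! (l - 1) \<ge> int l"
    and high: "\<forall>l. J + 1 \<le> l \<and> l \<le> length \<alpha> \<longrightarrow> \<alpha> ! (l - 1) = int J"
    using assms(2) by blast
  have hybrid_step: "(hybrid_sum \<alpha> (Suc p) :: 'k nsym) = hybrid_sum \<alpha> p"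
    if p: "1 \<le> p" "p < length \<alpha>" for p
  proof (rule hybrid_sum_Suc[OF p])
    fix u v :: nat
    assume uv: "1 \<le> u" "1 \<le> v"
      "0 < \<alpha> ! (p - 1) - int p + int u" "0 \<le> \<alpha> ! p - int (Suc p) + int v"
    consider "p < J" | "p = J" | "J < p" by linarith
    then show "0 < \<alpha> ! (p - 1) - int p + int v \<and> 0 \<le> \<alpha> ! p - int (Suc p) + int u"
    proof cases
      case 1
      then have "int p \<le> \<alpha> ! (p - 1)" "int (Suc p) \<le> \<alpha> ! p"
        using p low[THEN spec, of p] low[THEN spec, of "Suc p"] by simp_all
      then show ?thesis using uv by linarith
    next
      case 2
      then have "int p \<le> \<alpha> ! (p - 1)" "\<alpha> ! p = int p"
        using p low[THEN spec, of p] high[THEN spec, of "Suc p"] by simp_all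
      then show ?thesis using uv by linarith
    next
      case 3
      then have "\<alpha> ! (p - 1) = int J" "\<alpha> ! p = int J"
        using p high[THEN spec, of p] high[THEN spec, of "Suc p"] by simp_all
      then show ?thesis using uv by linarith
    qed
  qed
  have "(hybrid_sum \<alpha> p :: 'k nsym) = hybrid_sum \<alpha> 1" if "1 \<le> p" "p \<le> length \<alpha>" for p
    using that
  proof (induction p rule: dec_induct)
    case (step n)
    then show ?case using hybrid_step[of n] by simp
  qed simp
  from this[of "length \<alpha>"] have "(hybrid_sum \<alpha> (length \<alpha>) :: 'k nsym) = hybrid_sum \<alpha> 1"
    using J by simp
  moreover have "(hybrid_sum \<alpha> 1 :: 'k nsym) = immaculate \<alpha>"
    using J low[THEN spec, of 1] by (intro hybrid_sum_1) auto
  ultimately show ?thesis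
    by (simp add: hybrid_sum_length)
qed

end
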